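(* Let $F$ be a function which is analytic in a complex neighborhood of the real line $\mathbb R$, and suppose that $F$ is locally injective on $\mathbb R$. If the set of self-intersections $$\{(a,b)\in\mathbb R^2:\ a\ne b\text{ and }F(a)=F(b)\}$$ is uncountable, then $F(\mathbb R)$ is a loop in $\mathbb C$.
   Context: $F$ is locally injective on $\mathbb R$ if for every $t\in\mathbb R$ there is an open real interval containing $t$ on which (the restriction to real arguments of) $F$ is one-to-one. A loop in $\mathbb C$ is the image of a continuous map $L:[\gamma,\delta]\to\mathbb C$ (with $\gamma<\delta$ real) such that $L(\gamma)=L(\delta)$. *)

theory Defs
  imports "HOL-Complex_Analysis.Complex_Analysis"
begin

definition locally_injective_on_reals :: "(complex \<Rightarrow> complex) \<Rightarrow> bool" where
  "locally_injective_on_reals F \<longleftrightarrow>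
     (\<forall>t::real. \<exists>a b. a < t \<and> t < b \<and> inj_on (\<lambda>x. F (complex_of_real x)) {a<..<b})"

definition is_loop :: "complex set \<Rightarrow> bool" where
  "is_loop S \<longleftrightarrow>
     (\<exists>(g::real) d (L::real \<Rightarrow> complex). g < d \<and> continuous_on {g..d} L \<and> L g = L d
        \<and> L ` {g..d} = S)"

end

theory Submission
  imports Defs
begin

text \<open>
  Let \<open>f\<close> be the restriction of \<open>F\<close> to the reals. Local injectivity keeps the set of self-intersections
  away from the diagonal, so it is closed, and being uncountable it has a limit point \<open>(a, b)\<close>.
  A Puiseux argument shows that near a limit point the set is the graph of a
  strictly monotone continuous \<open>\<phi>\<close> with \<open>f \<circ> \<phi> = f\<close>: write \<open>F - F(b) = h\<^sup>l\<close> near \<open>b\<close> with a local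
  coordinate \<open>h\<close> and solve \<open>F(b + \<psi>(t)) = F(a \<plusminus> t\<^sup>l)\<close> for a holomorphic \<open>\<psi>\<close>; the right branch is
  real at infinitely many real points near 0, hence on all reals. If \<open>l\<close> is even, local injectivity
  forces \<open>\<psi>\<close> to be even and \<open>l\<close> can be halved; for odd \<open>l\<close> put \<open>\<phi>(a \<plusminus> t\<^sup>l) = b + \<psi>(t)\<close>.

  Assume \<open>a < b\<close>. Following a decreasing branch from \<open>(a, b)\<close> to the right would lead to the
  diagonal, so the branch is increasing. Following it from \<open>(b, a)\<close> to the right, it stays between
  \<open>a\<close> and the diagonal and thus never escapes to infinity: every \<open>x \<ge> b\<close> has some \<open>y\<close> with
  \<open>a \<le> y < x\<close> and \<open>f y = f x\<close>. The least point of \<open>[a, x]\<close> with value \<open>f x\<close> therefore lies in \<open>[a, b]\<close>.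
  With the mirror image of this, \<open>f\<close> maps \<open>[a, b]\<close> onto the whole range, and \<open>f a = f b\<close>.
\<close>

section \<open>Real branches of the equation \<open>G x = H y\<close>\<close>

text \<open>The reflection \<open>cnj \<circ> f \<circ> cnj\<close> is holomorphic on the same disc
  and agrees with \<open>f\<close> on \<open>X\<close>, which accumulates at 0. The identity theorem
  makes the two equal, and at a real point equality says that the value is its own
  conjugate.\<close>

lemma holomorphic_real_on_reals:
  assumes hol: "f holomorphic_on ball 0 r"
    and X: "X \<subseteq> \<real> \<inter> ball 0 r" "0 islimpt X" "f ` X \<subseteq> \<real>"
    and z: "z \<in> \<real> \<inter> ball 0 r"
  shows "f z \<in> \<real>"
proof -
  have r: "0 \<in> ball (0::complex) r"
    using z by (auto intro: le_less_trans[OF norm_ge_zero])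
  have "cnj ` ball 0 r = ball 0 r"
    by (force simp: image_iff intro!: bexI[of _ "cnj _"])
  then have "cnj \<circ> f \<circ> cnj holomorphic_on ball 0 r"
    using hol by (intro holomorphic_on_compose_cnj_cnj) auto
  then have "(\<lambda>w. f w - (cnj \<circ> f \<circ> cnj) w) holomorphic_on ball 0 r"
    by (intro holomorphic_on_diff hol)
  moreover have "f w - (cnj \<circ> f \<circ> cnj) w = 0" if "w \<in> X" for w
  proof -
    have "cnj w = w" "cnj (f w) = f w"
      using that X by (auto simp: Reals_cnj_iff)
    then show ?thesis by simp
  qed
  ultimately have "f z - (cnj \<circ> f \<circ> cnj) z = 0"
    using X z r
    by (intro analytic_continuation[where S = "ball 0 r" and U = X and \<xi> = 0 and w = z
          and f = "\<lambda>w. f w - (cnj \<circ> f \<circ> cnj) w"]) auto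
  moreover have "cnj z = z"
    using z by (auto simp: Reals_cnj_iff)
  ultimately show ?thesis
    by (simp add: Reals_cnj_iff)
qed

text \<open>The odd Taylor coefficients at 0 cancel, so \<open>f\<close> is a power series in the
  square of its argument. The witness is \<open>f\<close> after \<open>csqrt\<close>: evenness makes
  the choice of root, and hence the branch cut, harmless.\<close>

lemma even_holomorphic_function_of_square:
  assumes hol: "f holomorphic_on ball 0 r" and "r > 0"
    and even: "\<And>z. z \<in> ball 0 r \<Longrightarrow> f (- z) = f z"
  obtains g where "g holomorphic_on ball 0 (r\<^sup>2)" "\<And>z. z \<in> ball 0 r \<Longrightarrow> f z = g (z\<^sup>2)"
proof
  define a where "a = (\<lambda>n. (deriv ^^ n) f 0 / fact n)"
  have ser: "(\<lambda>n. a n * z ^ n) sums f z" if "z \<in> ball 0 r" for z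
    using holomorphic_power_series[OF hol that] by (simp add: a_def)
  have ser2: "(\<lambda>n. a (2 * n) * (z\<^sup>2) ^ n) sums f z" if z: "z \<in> ball 0 r" for z
  proof -
    \<comment> \<open>Averaging the series at \<open>z\<close> and \<open>- z\<close> kills the odd
      terms, and the reindexing by \<open>2 * n\<close> then drops them.\<close>
    have "(\<lambda>n. (a n * z ^ n + a n * (- z) ^ n) / 2) sums ((f z + f (- z)) / 2)"
      using z by (intro sums_divide sums_add ser) auto
    then have s: "(\<lambda>n. (a n * z ^ n + a n * (- z) ^ n) / 2) sums f z"
      using even[OF z] by simp
    have "(\<lambda>n. (a (2 * n) * z ^ (2 * n) + a (2 * n) * (- z) ^ (2 * n)) / 2) sums f z"
    proof (subst sums_mono_reindex[of "\<lambda>n. 2 * n"])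
      show "strict_mono (\<lambda>n::nat. 2 * n)"
        by (auto simp: strict_mono_def)
      show "(a n * z ^ n + a n * (- z) ^ n) / 2 = 0" if "n \<notin> range (\<lambda>n::nat. 2 * n)" for n
      proof -
        have "odd n"
          using that by (auto elim!: evenE)
        then show ?thesis by simp
      qed
    qed (rule s)
    then show ?thesis
      by (simp add: power_mult)
  qed
  have csqrt_in: "csqrt w \<in> ball 0 r" if "w \<in> ball 0 (r\<^sup>2)" for w
    using that \<open>r > 0\<close> by (simp add: real_less_lsqrt)
  show "(\<lambda>w. f (csqrt w)) holomorphic_on ball 0 (r\<^sup>2)"
    using ser2[OF csqrt_in] by (intro power_series_holomorphic[where a = "\<lambda>n. a (2 * n)"]) auto
  show "f z = f (csqrt (z\<^sup>2))" if "z \<in> ball 0 r" for z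
  proof -
    have "(csqrt (z\<^sup>2))\<^sup>2 = z\<^sup>2" by simp
    then have "csqrt (z\<^sup>2) = z \<or> csqrt (z\<^sup>2) = - z"
      by (simp only: power2_eq_iff)
    then show ?thesis
      using even[OF that] by auto
  qed
qed

text \<open>A disc is contractible, so a nonvanishing \<open>f\<close> has a holomorphic logarithm
  \<open>q\<close>, and \<open>exp (q z / of_nat n)\<close> is a root.\<close>

lemma holomorphic_nth_root_exists:
  assumes "f holomorphic_on ball (c::complex) r" "\<And>z. z \<in> ball c r \<Longrightarrow> f z \<noteq> 0" "n > 0"
  obtains g where "g holomorphic_on ball c r" "\<And>z. z \<in> ball c r \<Longrightarrow> g z ^ n = f z"
    "\<And>z. z \<in> ball c r \<Longrightarrow> g z \<noteq> 0"
proof -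
  obtain q where q: "q holomorphic_on ball c r" "\<And>z. z \<in> ball c r \<Longrightarrow> f z = exp (q z)"
    using contractible_imp_holomorphic_log[OF assms(1) _ assms(2)] convex_imp_contractible[OF convex_ball]
    by metis
  show ?thesis
  proof
    show "(\<lambda>z. exp (q z / of_nat n)) holomorphic_on ball c r"
      using \<open>n > 0\<close> by (intro holomorphic_intros q) auto
    show "exp (q z / of_nat n) ^ n = f z" if "z \<in> ball c r" for z
      using q(2)[OF that] \<open>n > 0\<close> by (simp flip: exp_of_nat_mult)
  qed auto
qed

text \<open>Factor out the zero as \<open>z ^ n * g z\<close> and write the nonvanishing
  \<open>g\<close> as \<open>q ^ n\<close>. Then \<open>h z = z * q z\<close> satisfies
  \<open>f = h ^ n\<close> and has the nonzero derivative \<open>q 0\<close> at 0, so it is a local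
  coordinate with inverse \<open>k\<close>.\<close>

lemma holomorphic_zero_power_of_local_coordinate:
  assumes hol: "f holomorphic_on ball 0 r" and "r > 0" "f 0 = 0" "\<not> f constant_on ball 0 r"
  obtains n s h k where "n > 0" "s > 0" "s \<le> r" "h holomorphic_on ball 0 s"
    "open (h ` ball 0 s)" "k holomorphic_on h ` ball 0 s" "h 0 = 0"
    "\<And>z. z \<in> ball 0 s \<Longrightarrow> f z = h z ^ n" "\<And>z. z \<in> ball 0 s \<Longrightarrow> k (h z) = z"
proof -
  obtain g s n where g: "0 < n" "0 < s" "ball 0 s \<subseteq> ball (0::complex) r" "g holomorphic_on ball 0 s"
    "\<And>w. w \<in> ball 0 s \<Longrightarrow> f w = (w - 0) ^ n * g w" "\<And>w. w \<in> ball 0 s \<Longrightarrow> g w \<noteq> 0"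
    using holomorphic_factor_zero_nonconstant[OF hol open_ball connected_ball _ assms(3,4)] \<open>r > 0\<close>
    by (metis centre_in_ball)
  obtain q where q: "q holomorphic_on ball 0 s" "\<And>z. z \<in> ball 0 s \<Longrightarrow> q z ^ n = g z"
    "\<And>z. z \<in> ball 0 s \<Longrightarrow> q z \<noteq> 0"
    using holomorphic_nth_root_exists[OF g(4) g(6) g(1)] by metis
  define h where "h = (\<lambda>z. z * q z)"
  have h: "h holomorphic_on ball 0 s"
    unfolding h_def by (intro holomorphic_intros q)
  have "(q has_field_derivative deriv q 0) (at 0)"
    using holomorphic_derivI[OF q(1)] g(2) by simp
  then have "(h has_field_derivative q 0) (at 0)"
    unfolding h_def by (auto intro!: derivative_eq_intros)
  then have "deriv h 0 \<noteq> 0"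
    using q(3) g(2) by (simp add: DERIV_imp_deriv)
  then obtain t where t: "t > 0" "ball 0 t \<subseteq> ball (0::complex) s" "open (h ` ball 0 t)" "inj_on h (ball 0 t)"
    using has_complex_derivative_locally_invertible[OF h, of 0] g(2) by auto
  have ht: "h holomorphic_on ball 0 t"
    using h t(2) by (rule holomorphic_on_subset)
  obtain k where k: "k holomorphic_on h ` ball 0 t" "\<And>z. z \<in> ball 0 t \<Longrightarrow> k (h z) = z"
    using holomorphic_has_inverse[OF ht open_ball t(4)] by metis
  show ?thesis
  proof
    show "t \<le> r"
      using t(1,2) g(2,3) by (auto simp: ball_subset_ball_iff)
    show "f z = h z ^ n" if "z \<in> ball 0 t" for z
      using that t(2) g(5)[of z] q(2)[of z] by (auto simp: h_def power_mult_distrib)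
  qed (use g t ht k in \<open>auto simp: h_def\<close>)
qed

section \<open>Real Puiseux branches and the reduction to odd exponents\<close>

text \<open>A Puiseux parametrisation \<open>x = \<sigma> * t ^ l\<close>,
  \<open>y = \<psi> t\<close> of a real solution branch of \<open>G x = H y\<close> through the
  origin. The sign is there because for even \<open>l\<close> and real \<open>t\<close> the power
  \<open>t ^ l\<close> reaches only one side of 0.\<close>

definition real_branch :: "(complex \<Rightarrow> complex) \<Rightarrow> (complex \<Rightarrow> complex) \<Rightarrow> nat \<Rightarrow> bool" where
  "real_branch G H l \<longleftrightarrow> (\<exists>\<sigma>\<in>{1, - 1 :: complex}. \<exists>r>0. \<exists>\<psi>. \<psi> holomorphic_on ball 0 r \<and> \<psi> 0 = 0 \<and>
     (\<forall>t\<in>\<real> \<inter> ball 0 r. \<psi> t \<in> \<real>) \<and> (\<forall>t\<in>ball 0 r. H (\<psi> t) = G (\<sigma> * t ^ l)))"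

text \<open>In a coordinate \<open>h\<close> with \<open>H = h ^ l\<close>, the substitution
  \<open>x = \<sigma> * t ^ l\<close> turns \<open>G\<close> into an \<open>l\<close>-th power of
  some \<open>m \<sigma>\<close> as well. So the equation splits into
  \<open>h y = \<omega> * m \<sigma> t\<close> with \<open>\<omega> ^ l = 1\<close>, each solved by
  inverting \<open>h\<close>. A family with accumulating real solutions gives a branch that is real
  on all real parameters.\<close>

lemma real_branch_exists:
  assumes G: "G holomorphic_on ball 0 r" "G 0 = 0" "\<not> G constant_on ball 0 r"
    and H: "H holomorphic_on ball 0 r" "H 0 = 0" "\<not> H constant_on ball 0 r"
    and "r > 0"
    and X: "(0, 0) islimpt X"
      "\<And>x y. (x, y) \<in> X \<Longrightarrow> x \<noteq> 0 \<and> G (complex_of_real x) = H (complex_of_real y)"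
  obtains l where "l > 0" "real_branch G H l"
proof -
  obtain g r1 k where g: "0 < k" "0 < r1" "ball 0 r1 \<subseteq> ball (0::complex) r" "g holomorphic_on ball 0 r1"
    "\<And>w. w \<in> ball 0 r1 \<Longrightarrow> G w = (w - 0) ^ k * g w" "\<And>w. w \<in> ball 0 r1 \<Longrightarrow> g w \<noteq> 0"
    using holomorphic_factor_zero_nonconstant[OF G(1) open_ball connected_ball _ G(2,3)] \<open>r > 0\<close>
    by (metis centre_in_ball)
  obtain l s h hi where h: "l > 0" "s > 0" "s \<le> r" "h holomorphic_on ball 0 s"
    "open (h ` ball 0 s)" "hi holomorphic_on h ` ball 0 s" "h 0 = 0"
    "\<And>z. z \<in> ball 0 s \<Longrightarrow> H z = h z ^ l" "\<And>z. z \<in> ball 0 s \<Longrightarrow> hi (h z) = z"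
    using holomorphic_zero_power_of_local_coordinate[OF H(1) \<open>r > 0\<close> H(2,3)] by metis
  \<comment> \<open>The bound 1 makes \<open>norm (t ^ l)\<close> at most \<open>norm t\<close>, so
    the substituted argument stays in the disc where \<open>G\<close> is factored.\<close>
  define \<rho> where "\<rho> = min 1 r1"
  have \<rho>: "\<rho> > 0" using g(2) by (simp add: \<rho>_def)
  have pow_in: "\<sigma> * t ^ l \<in> ball 0 r1" if "t \<in> ball 0 \<rho>" "\<sigma> \<in> {1, - 1}" for t \<sigma> :: complex
  proof -
    have "norm t ^ l \<le> norm t ^ 1"
      using that h(1) by (intro power_decreasing) (auto simp: \<rho>_def)
    then show ?thesis
      using that by (auto simp: \<rho>_def norm_mult norm_power)
  qed
  \<comment> \<open>\<open>G (\<sigma> * t ^ l)\<close> equals \<open>(t ^ k) ^ l\<close> times the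
    nonvanishing \<open>\<sigma> ^ k * g (\<sigma> * t ^ l)\<close>. With an \<open>l\<close>-th
    root \<open>R\<close> of that factor, \<open>m\<close> is \<open>t ^ k * R t\<close>.\<close>
  have "\<exists>m. m holomorphic_on ball 0 \<rho> \<and> m 0 = 0 \<and>
          (\<forall>t\<in>ball 0 \<rho>. G (\<sigma> * t ^ l) = m t ^ l \<and> (t \<noteq> 0 \<longrightarrow> m t \<noteq> 0))"
    if \<sigma>: "\<sigma> \<in> {1, - 1}" for \<sigma>
  proof -
    have "(\<lambda>t. \<sigma> ^ k * g (\<sigma> * t ^ l)) holomorphic_on ball 0 \<rho>"
      using pow_in[OF _ \<sigma>]
      by (intro holomorphic_intros holomorphic_on_compose_gen[OF _ g(4), unfolded o_def]) auto
    then obtain R where R: "R holomorphic_on ball 0 \<rho>"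
      "\<And>t. t \<in> ball 0 \<rho> \<Longrightarrow> R t ^ l = \<sigma> ^ k * g (\<sigma> * t ^ l)"
      "\<And>t. t \<in> ball 0 \<rho> \<Longrightarrow> R t \<noteq> 0"
      using holomorphic_nth_root_exists[of "\<lambda>t. \<sigma> ^ k * g (\<sigma> * t ^ l)" 0 \<rho> l] g(6) pow_in[OF _ \<sigma>] \<sigma> h(1)
      by (metis (no_types, lifting) insert_iff mult_eq_0_iff neg_equal_0_iff_equal power_eq_0_iff empty_iff zero_neq_one)
    show ?thesis
    proof (intro exI[of _ "\<lambda>t. t ^ k * R t"] conjI ballI impI)
      show "(\<lambda>t. t ^ k * R t) holomorphic_on ball 0 \<rho>"
        by (intro holomorphic_intros R)
      show "G (\<sigma> * t ^ l) = (t ^ k * R t) ^ l" if "t \<in> ball 0 \<rho>" for t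
        using g(5)[OF pow_in[OF that \<sigma>]] R(2)[OF that]
        by (simp add: power_mult_distrib mult.commute flip: power_mult)
    qed (use g(1) R(3) in auto)
  qed
  then have "\<forall>\<sigma>\<in>{1, - 1}. \<exists>m. m holomorphic_on ball 0 \<rho> \<and> m 0 = 0 \<and>
          (\<forall>t\<in>ball 0 \<rho>. G (\<sigma> * t ^ l) = m t ^ l \<and> (t \<noteq> 0 \<longrightarrow> m t \<noteq> 0))"
    by blast
  from bchoice[OF this] obtain m where "\<forall>\<sigma>\<in>{1, - 1}. m \<sigma> holomorphic_on ball 0 \<rho> \<and> m \<sigma> 0 = 0 \<and>
          (\<forall>t\<in>ball 0 \<rho>. G (\<sigma> * t ^ l) = m \<sigma> t ^ l \<and> (t \<noteq> 0 \<longrightarrow> m \<sigma> t \<noteq> 0))"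
    by blast
  then have m: "\<And>\<sigma>. \<sigma> \<in> {1, - 1} \<Longrightarrow> m \<sigma> holomorphic_on ball 0 \<rho>"
      "\<And>\<sigma>. \<sigma> \<in> {1, - 1} \<Longrightarrow> m \<sigma> 0 = 0"
      "\<And>\<sigma> t. \<sigma> \<in> {1, - 1} \<Longrightarrow> t \<in> ball 0 \<rho> \<Longrightarrow> G (\<sigma> * t ^ l) = m \<sigma> t ^ l"
      "\<And>\<sigma> t. \<sigma> \<in> {1, - 1} \<Longrightarrow> t \<in> ball 0 \<rho> \<Longrightarrow> t \<noteq> 0 \<Longrightarrow> m \<sigma> t \<noteq> 0"
    by blast+
  \<comment> \<open>The given solutions split into finitely many families, according to the sign of \<open>x\<close> and the
    root of unity \<open>\<omega>\<close> relating the two \<open>l\<close>-th roots; one family still accumulates at the origin.\<close>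
  define \<tau> where "\<tau> = (\<lambda>x. complex_of_real (root l \<bar>x\<bar>))"
  have \<tau>0: "isCont \<tau> 0" "\<tau> 0 = 0"
    unfolding \<tau>_def by (intro continuous_intros) auto
  define X' where "X' = X \<inter> {p. \<tau> (fst p) \<in> ball 0 \<rho> \<and> snd p \<in> ball 0 s}"
  define Y where "Y = (\<lambda>(\<sigma>, \<omega>). {p\<in>X'. complex_of_real (fst p) = \<sigma> * \<tau> (fst p) ^ l \<and>
     h (complex_of_real (snd p)) = \<omega> * m \<sigma> (\<tau> (fst p))})"
  have ev: "\<forall>\<^sub>F p::real\<times>real in at (0, 0). \<tau> (fst p) \<in> ball 0 \<rho> \<and> snd p \<in> ball 0 s"
  proof (intro eventually_conj)
    have "isCont (\<lambda>p::real\<times>real. \<tau> (fst p)) (0, 0)"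
      using \<tau>0 by (intro continuous_at_compose[of _ fst \<tau>, unfolded o_def] continuous_intros) auto
    then have "(\<lambda>p::real\<times>real. \<tau> (fst p)) \<midarrow>(0, 0)\<rightarrow> 0"
      using \<tau>0 by (simp add: isCont_def)
    then show "\<forall>\<^sub>F p::real\<times>real in at (0, 0). \<tau> (fst p) \<in> ball 0 \<rho>"
      using \<rho> by (intro topological_tendstoD) auto
    have "(\<lambda>p::real\<times>real. snd p) \<midarrow>(0, 0)\<rightarrow> 0"
      by (rule tendsto_eq_rhs[OF tendsto_snd[OF tendsto_ident_at]]) simp
    then show "\<forall>\<^sub>F p::real\<times>real in at (0, 0). snd p \<in> ball 0 s"
      using h(2) by (intro topological_tendstoD) auto
  qed
  have "(0, 0) islimpt X'"
  proof (rule ccontr)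
    assume "\<not> (0, 0) islimpt X'"
    then have "\<forall>\<^sub>F p in at (0, 0). p \<notin> X'"
      by (simp add: islimpt_iff_eventually)
    with ev have "\<forall>\<^sub>F p in at (0, 0). p \<notin> X"
      by eventually_elim (simp add: X'_def)
    then show False
      using X(1) by (simp add: islimpt_iff_eventually)
  qed
  moreover have "X' \<subseteq> (\<Union>q\<in>{1, - 1} \<times> {\<omega>. \<omega> ^ l = 1}. Y q)"
  proof
    fix p assume p: "p \<in> X'"
    obtain x y where xy: "p = (x, y)" by (cases p)
    define \<sigma> where "\<sigma> = complex_of_real (sgn x)"
    have x0: "x \<noteq> 0" and GH: "G (complex_of_real x) = H (complex_of_real y)"
      using X(2) p xy unfolding X'_def by auto
    have \<sigma>: "\<sigma> \<in> {1, - 1}" using x0 by (auto simp: \<sigma>_def sgn_real_def)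
    have "x = sgn x * root l \<bar>x\<bar> ^ l"
      using h(1) x0 by (simp add: sgn_mult_abs)
    then have xe: "complex_of_real x = \<sigma> * \<tau> x ^ l"
      unfolding \<sigma>_def \<tau>_def by (metis of_real_mult of_real_power)
    have t: "\<tau> x \<in> ball 0 \<rho>" "\<tau> x \<noteq> 0" and ys: "complex_of_real y \<in> ball 0 s"
      using p xy x0 h(1) by (auto simp: X'_def \<tau>_def)
    have "h y ^ l = m \<sigma> (\<tau> x) ^ l"
      using GH h(8)[OF ys] m(3)[OF \<sigma> t(1)] xe by simp
    moreover have "m \<sigma> (\<tau> x) \<noteq> 0"
      using m(4)[OF \<sigma> t] .
    ultimately have "(h y / m \<sigma> (\<tau> x)) ^ l = 1" "h y = (h y / m \<sigma> (\<tau> x)) * m \<sigma> (\<tau> x)"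
      by (simp_all add: power_divide)
    then have "p \<in> Y (\<sigma>, h y / m \<sigma> (\<tau> x))"
      using p xe unfolding Y_def xy by simp
    then show "p \<in> (\<Union>q\<in>{1, - 1} \<times> {\<omega>. \<omega> ^ l = 1}. Y q)"
      using \<open>(h y / m \<sigma> (\<tau> x)) ^ l = 1\<close> \<sigma> by (intro UN_I[of "(\<sigma>, h y / m \<sigma> (\<tau> x))"]) simp_all
  qed
  ultimately have "(0, 0) islimpt (\<Union>q\<in>{1, - 1} \<times> {\<omega>. \<omega> ^ l = 1}. Y q)"
    by (rule islimpt_subset)
  moreover have "finite ({1, - 1 :: complex} \<times> {\<omega>::complex. \<omega> ^ l = 1})"
    using h(1) by (intro finite_cartesian_product finite_roots_unity) auto
  ultimately obtain \<sigma> \<omega> where so: "\<sigma> \<in> {1, - 1}" "\<omega> ^ l = 1" "(0, 0) islimpt Y (\<sigma>, \<omega>)"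
    by (subst (asm) islimpt_finite_union_iff) auto
  \<comment> \<open>The inverse \<open>hi\<close> is available on the image of \<open>h\<close>.
    That image is open and contains \<open>0 = h 0\<close>, so
    \<open>\<omega> * m \<sigma> t\<close> stays in it for small \<open>t\<close>.\<close>
  have "continuous_on (ball 0 \<rho>) (\<lambda>t. \<omega> * m \<sigma> t)"
    by (intro continuous_intros holomorphic_on_imp_continuous_on m so)
  then have "isCont (\<lambda>t. \<omega> * m \<sigma> t) 0"
    using \<rho> by (simp add: continuous_on_eq_continuous_at)
  then have "((\<lambda>t. \<omega> * m \<sigma> t) \<longlongrightarrow> \<omega> * m \<sigma> 0) (nhds 0)"
    by (metis isCont_def tendsto_at_iff_tendsto_nhds)
  moreover have "\<omega> * m \<sigma> 0 \<in> h ` ball 0 s"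
    using h(2,7) m(2)[OF so(1)] by force
  ultimately have "\<forall>\<^sub>F t in nhds 0. \<omega> * m \<sigma> t \<in> h ` ball 0 s"
    using h(5) topological_tendstoD by blast
  then obtain d where d: "d > 0" "\<And>t. dist t 0 < d \<Longrightarrow> \<omega> * m \<sigma> t \<in> h ` ball 0 s"
    unfolding eventually_nhds_metric by auto
  define e where "e = min d \<rho>"
  define \<psi> where "\<psi> = (\<lambda>t. hi (\<omega> * m \<sigma> t))"
  have e: "e > 0" "ball 0 e \<subseteq> ball (0::complex) \<rho>" using d \<rho> by (auto simp: e_def)
  have me: "m \<sigma> holomorphic_on ball 0 e"
    using m(1)[OF so(1)] e(2) by (rule holomorphic_on_subset)
  have in_image: "\<omega> * m \<sigma> t \<in> h ` ball 0 s" if "t \<in> ball 0 e" for t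
    using d(2)[of t] that by (auto simp: e_def)
  have \<psi>hol: "\<psi> holomorphic_on ball 0 e"
    unfolding \<psi>_def using in_image
    by (intro holomorphic_on_compose_gen[OF _ h(6), unfolded o_def] holomorphic_intros me) auto
  have \<psi>eq: "H (\<psi> t) = G (\<sigma> * t ^ l)" if t: "t \<in> ball 0 e" for t
  proof -
    obtain w where w: "w \<in> ball 0 s" "\<omega> * m \<sigma> t = h w"
      using in_image[OF t] by auto
    then have "H (\<psi> t) = h w ^ l"
      using h(8,9) by (simp add: \<psi>_def)
    also have "\<dots> = G (\<sigma> * t ^ l)"
      using m(3)[OF so(1)] t e(2) so(2) by (auto simp: power_mult_distrib simp flip: w(2))
    finally show ?thesis .
  qed
  \<comment> \<open>The parameters of the given solutions: there
    \<open>h y = \<omega> * m \<sigma> t\<close> with real \<open>y\<close>, so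
    \<open>\<psi> t\<close> is that \<open>y\<close>.\<close>
  define T where "T = (\<tau> \<circ> fst) ` Y (\<sigma>, \<omega>) \<inter> ball 0 e"
  have real: "\<psi> t \<in> \<real>" if t: "t \<in> T" for t
  proof -
    obtain x y where "(x, y) \<in> Y (\<sigma>, \<omega>)" "t = \<tau> x" using t by (auto simp: T_def)
    then have "complex_of_real y \<in> ball 0 s" "h y = \<omega> * m \<sigma> t"
      by (auto simp: Y_def X'_def)
    then show ?thesis
      using h(9) unfolding \<psi>_def by (metis Reals_of_real)
  qed
  have "0 islimpt T"
    unfolding islimpt_approachable
  proof (intro allI impI)
    fix \<epsilon> :: real assume \<epsilon>: "\<epsilon> > 0"
    have "(\<tau> \<longlongrightarrow> \<tau> 0) (nhds 0)"
      using \<tau>0(1) by (metis isCont_def tendsto_at_iff_tendsto_nhds)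
    then have "\<forall>\<^sub>F x in nhds 0. \<tau> x \<in> ball 0 (min e \<epsilon>)"
      using e \<epsilon> \<tau>0(2) by (intro topological_tendstoD) auto
    then obtain d' where d': "d' > 0" "\<And>x. dist x 0 < d' \<Longrightarrow> \<tau> x \<in> ball 0 (min e \<epsilon>)"
      unfolding eventually_nhds_metric by auto
    obtain x y where xy: "(x, y) \<in> Y (\<sigma>, \<omega>)" "dist (x, y) (0, 0) < d'"
      using so(3) d'(1) unfolding islimpt_approachable by (metis surj_pair)
    have "dist x 0 < d'"
      using xy(2) dist_fst_le[of "(x, y)" "(0, 0)"] by simp
    then have "\<tau> x \<in> ball 0 (min e \<epsilon>)" by (rule d')
    \<comment> \<open>Here the nonzero first coordinates of \<open>X\<close> enter: the parameters
      come close to 0 without being 0.\<close>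
    moreover have "\<tau> x \<noteq> 0"
      using xy(1) X(2)[of x y] h(1) by (auto simp: Y_def X'_def \<tau>_def)
    ultimately show "\<exists>x'\<in>T. x' \<noteq> 0 \<and> dist x' 0 < \<epsilon>"
      using xy(1) by (intro bexI[of _ "\<tau> x"]) (auto simp: T_def intro!: image_eqI[of _ _ "(x, y)"])
  qed
  moreover have "T \<subseteq> \<real> \<inter> ball 0 e"
    by (auto simp: T_def \<tau>_def)
  ultimately have "\<forall>t\<in>\<real> \<inter> ball 0 e. \<psi> t \<in> \<real>"
    using real holomorphic_real_on_reals[OF \<psi>hol, of T] by blast
  moreover have "\<psi> 0 = 0"
    using h(2,7,9) m(2)[OF so(1)] unfolding \<psi>_def by (metis mult_zero_right centre_in_ball)
  ultimately have "real_branch G H l"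
    unfolding real_branch_def using so(1) e(1) \<psi>hol \<psi>eq by blast
  then show ?thesis using h(1) that by blast
qed


text \<open>The parameters \<open>t\<close> and \<open>- t\<close> give the same \<open>x\<close>,
  so for small real \<open>t\<close> the real values \<open>\<psi> t\<close> and
  \<open>\<psi> (- t)\<close> have the same image under \<open>H\<close> and coincide by
  injectivity. The identity theorem makes \<open>\<psi>\<close> even, hence a function of the square
  of \<open>t\<close>, which serves as the new parameter.\<close>

lemma real_branch_half:
  assumes "real_branch G H (2 * l)" "l > 0"
    and inj: "inj_on (\<lambda>x. H (complex_of_real x)) {- d<..<d}" "d > 0"
  shows "real_branch G H l"
proof -
  obtain \<sigma> r \<psi> where \<sigma>: "\<sigma> \<in> {1, - 1 :: complex}" and "r > 0" and hol: "\<psi> holomorphic_on ball 0 r"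
    and \<psi>0: "\<psi> 0 = 0" and real: "\<And>t. t \<in> \<real> \<inter> ball 0 r \<Longrightarrow> \<psi> t \<in> \<real>"
    and eq: "\<And>t. t \<in> ball 0 r \<Longrightarrow> H (\<psi> t) = G (\<sigma> * t ^ (2 * l))"
    using assms(1) unfolding real_branch_def by blast
  have "isCont \<psi> 0"
    using holomorphic_on_imp_continuous_on[OF hol] \<open>r > 0\<close> by (simp add: continuous_on_eq_continuous_at)
  then obtain e where e: "e > 0" "\<And>t. dist t 0 < e \<Longrightarrow> dist (\<psi> t) 0 < d"
    using \<open>d > 0\<close> \<psi>0 unfolding continuous_at_eps_delta by metis
  define s where "s = min e r"
  have s: "s > 0" "s \<le> e" "s \<le> r" using e \<open>r > 0\<close> by (auto simp: s_def)
  have even_real: "\<psi> (- t) = \<psi> t" if t: "t \<in> \<real> \<inter> ball 0 s" for t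
  proof -
    have "\<psi> t \<in> \<real>" "\<psi> (- t) \<in> \<real>"
      using real[of t] real[of "- t"] t s by auto
    then obtain u v where uv: "\<psi> t = complex_of_real u" "\<psi> (- t) = complex_of_real v"
      by (metis Reals_cases)
    have "norm (\<psi> t) < d" "norm (\<psi> (- t)) < d"
      using e(2)[of t] e(2)[of "- t"] t s by auto
    then have "u \<in> {- d<..<d}" "v \<in> {- d<..<d}"
      by (auto simp: uv)
    moreover have "H (complex_of_real u) = H (complex_of_real v)"
      using eq[of t] eq[of "- t"] t s by (simp add: uv)
    ultimately have "u = v"
      using inj(1) by (simp add: inj_on_def)
    then show ?thesis using uv by simp
  qed
  have lim: "0 islimpt (\<real> \<inter> ball (0::complex) q)" if "q > 0" for q :: real
    unfolding islimpt_approachable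
  proof (intro allI impI)
    fix \<epsilon> :: real assume "\<epsilon> > 0"
    then show "\<exists>x'\<in>\<real> \<inter> ball (0::complex) q. x' \<noteq> 0 \<and> dist x' 0 < \<epsilon>"
      using \<open>q > 0\<close> by (intro bexI[of _ "complex_of_real (min q \<epsilon> / 2)"]) (auto simp: min_def)
  qed
  have "\<psi> (- t) - \<psi> t = 0" if "t \<in> ball 0 r" for t
  proof (rule analytic_continuation[of "\<lambda>t. \<psi> (- t) - \<psi> t" "ball 0 r" "\<real> \<inter> ball 0 s" 0])
    show "(\<lambda>t. \<psi> (- t) - \<psi> t) holomorphic_on ball 0 r"
      by (intro holomorphic_intros hol holomorphic_on_compose_gen[OF _ hol, unfolded o_def]) auto
  qed (use s that \<open>r > 0\<close> even_real lim in auto)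
  then obtain \<Psi> where \<Psi>: "\<Psi> holomorphic_on ball 0 (r\<^sup>2)" "\<And>z. z \<in> ball 0 r \<Longrightarrow> \<psi> z = \<Psi> (z\<^sup>2)"
    using even_holomorphic_function_of_square[OF hol \<open>r > 0\<close>] by (metis right_minus_eq)
  have csqrt_in: "csqrt w \<in> ball 0 r" if "w \<in> ball 0 (r\<^sup>2)" for w
    using that \<open>r > 0\<close> by (simp add: real_less_lsqrt)
  \<comment> \<open>At positive squares \<open>\<Psi>\<close> inherits real values from
    \<open>\<psi>\<close>. They accumulate at 0, so reality extends to negative parameters, which
    are not squares of real numbers.\<close>
  define T where "T = (\<lambda>x. complex_of_real (x\<^sup>2)) ` {0<..<r}"
  have "0 islimpt T"
    unfolding islimpt_approachable
  proof (intro allI impI)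
    fix \<epsilon> :: real assume "\<epsilon> > 0"
    define x where "x = min (min r 1) \<epsilon> / 2"
    have x: "x \<in> {0<..<r}" "x < 1" "x < \<epsilon>"
      using \<open>\<epsilon> > 0\<close> \<open>r > 0\<close> by (auto simp: x_def min_def)
    moreover have "x\<^sup>2 < \<epsilon>"
      using x mult_strict_mono[of x 1 x \<epsilon>] by (simp add: power2_eq_square)
    ultimately show "\<exists>x'\<in>T. x' \<noteq> 0 \<and> dist x' 0 < \<epsilon>"
      unfolding T_def by (intro bexI[OF _ imageI[of x]]) (auto simp: norm_power)
  qed
  moreover have "T \<subseteq> \<real> \<inter> ball 0 (r\<^sup>2)"
    by (auto simp: T_def norm_power intro!: power_strict_mono)
  moreover have "\<Psi> ` T \<subseteq> \<real>"
  proof (clarsimp simp: T_def)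
    fix x assume "0 < x" "x < r"
    then show "\<Psi> ((complex_of_real x)\<^sup>2) \<in> \<real>"
      using \<Psi>(2)[of "complex_of_real x"] real[of "complex_of_real x"] by simp
  qed
  ultimately have "\<forall>t\<in>\<real> \<inter> ball 0 (r\<^sup>2). \<Psi> t \<in> \<real>"
    using holomorphic_real_on_reals[OF \<Psi>(1)] by blast
  moreover have "\<Psi> 0 = 0"
    using \<Psi>(2)[of 0] \<psi>0 \<open>r > 0\<close> by simp
  moreover have "\<forall>t\<in>ball 0 (r\<^sup>2). H (\<Psi> t) = G (\<sigma> * t ^ l)"
  proof
    fix t :: complex assume "t \<in> ball 0 (r\<^sup>2)"
    then have "csqrt t \<in> ball 0 r" by (rule csqrt_in)
    then show "H (\<Psi> t) = G (\<sigma> * t ^ l)"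
      using \<Psi>(2)[of "csqrt t"] eq[of "csqrt t"] by (simp add: power_mult)
  qed
  moreover have "r\<^sup>2 > 0" using \<open>r > 0\<close> by simp
  ultimately show ?thesis
    unfolding real_branch_def using \<sigma> \<Psi>(1) by blast
qed

text \<open>An even positive exponent can be halved, so the descent stops at an odd one. For odd
  \<open>n\<close> the power \<open>t ^ n\<close> is a bijection of the real line, so the branch
  covers both sides of 0.\<close>

lemma real_branch_odd:
  assumes "real_branch G H l" "l > 0"
    and inj: "inj_on (\<lambda>x. H (complex_of_real x)) {- d<..<d}" "d > 0"
  obtains n where "odd n" "real_branch G H n"
proof -
  have "\<exists>n. odd n \<and> real_branch G H n"
    using assms(1,2)
  proof (induction l rule: less_induct)
    case (less l)
    show ?case
    proof (cases "even l")
      case True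
      then obtain k where k: "l = 2 * k" by (elim evenE)
      then have "real_branch G H k"
        using less.prems real_branch_half[OF _ _ inj] by simp
      then show ?thesis
        using less.IH[of k] k less.prems by simp
    qed (use less.prems in blast)
  qed
  then show ?thesis using that by blast
qed

section \<open>Continuation of self-intersections\<close>

text \<open>Let \<open>t\<close> be the infimum of the failures beyond \<open>b\<close>. Then
  \<open>Q t\<close> follows from \<open>lim\<close>, or from the start if \<open>t = b\<close>, and
  \<open>step\<close> leaves no failure just above \<open>t\<close>, contrary to the choice of
  \<open>t\<close>.\<close>

lemma real_interval_induct:
  fixes b x :: real
  assumes "Q b" "b \<le> x"
    and step: "\<And>t. b \<le> t \<Longrightarrow> Q t \<Longrightarrow> \<exists>d>0. \<forall>x. t < x \<and> x < t + d \<longrightarrow> Q x"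
    and lim: "\<And>t. b < t \<Longrightarrow> \<forall>x. b \<le> x \<and> x < t \<longrightarrow> Q x \<Longrightarrow> Q t"
  shows "Q x"
proof (rule ccontr)
  assume "\<not> Q x"
  define B where "B = {x. b \<le> x \<and> \<not> Q x}"
  have B: "B \<noteq> {}" "bdd_below B"
    using \<open>\<not> Q x\<close> \<open>b \<le> x\<close> by (auto simp: B_def bdd_below_def)
  define t where "t = Inf B"
  have "b \<le> t"
    unfolding t_def using B(1) by (intro cInf_greatest) (auto simp: B_def)
  have below: "\<forall>x. b \<le> x \<and> x < t \<longrightarrow> Q x"
    using cInf_lower[OF _ B(2)] unfolding t_def B_def by force
  have "Q t"
    using \<open>Q b\<close> lim[OF _ below] \<open>b \<le> t\<close> by (cases "t = b") auto
  then obtain d where d: "d > 0" "\<And>x. t < x \<Longrightarrow> x < t + d \<Longrightarrow> Q x"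
    using step[OF \<open>b \<le> t\<close>] by blast
  obtain y where "y \<in> B" "y < t + d"
    using cInf_lessD[OF B(1), of "t + d"] d(1) unfolding t_def by auto
  moreover have "t \<le> y"
    unfolding t_def using \<open>y \<in> B\<close> B(2) by (rule cInf_lower)
  ultimately show False
    using d(2)[of y] \<open>Q t\<close> unfolding B_def by (cases "y = t") auto
qed

lemma sequence_strictly_below:
  fixes a t :: real
  assumes "a < t"
  obtains X where "\<And>n. a < X n" "\<And>n. X n < t" "X \<longlonglongrightarrow> t"
proof
  \<comment> \<open>With the full difference \<open>t - a\<close> the term at \<open>n = 0\<close>
    would be \<open>a\<close> itself; halving keeps it strictly above.\<close>
  define X where "X = (\<lambda>n. t - (t - a) / 2 * inverse (real (Suc n)))"
  show "X n < t" for n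
    using assms by (simp add: X_def)
  have "inverse (real (Suc n)) \<le> 1" for n
    by (simp add: field_simps)
  then have "(t - a) / 2 * inverse (real (Suc n)) \<le> (t - a) / 2 * 1" for n
    using assms by (intro mult_left_mono) auto
  moreover have "(t - a) / 2 * 1 < t - a"
    using assms by simp
  ultimately show "a < X n" for n
    unfolding X_def by (smt (verit))
  have "X \<longlonglongrightarrow> t - (t - a) / 2 * 0"
    unfolding X_def by (intro tendsto_intros LIMSEQ_inverse_real_of_nat)
  then show "X \<longlonglongrightarrow> t" by simp
qed

section \<open>Self-intersections near a limit point as a monotone graph\<close>

locale locally_injective_analytic =
  fixes F :: "complex \<Rightarrow> complex"
  assumes analytic: "F analytic_on \<real>"
    and loc_inj: "locally_injective_on_reals F"
begin

definition selfint :: "(real \<times> real) set" where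
  "selfint = {(a, b). a \<noteq> b \<and> F (complex_of_real a) = F (complex_of_real b)}"

lemma selfint_sym: "(x, y) \<in> selfint \<longleftrightarrow> (y, x) \<in> selfint"
  by (auto simp: selfint_def)

lemma injective_nhd:
  obtains d where "d > 0" "inj_on (\<lambda>x. F (complex_of_real x)) {t - d<..<t + d}"
proof -
  obtain a b where ab: "a < t" "t < b" "inj_on (\<lambda>x. F (complex_of_real x)) {a<..<b}"
    using loc_inj unfolding locally_injective_on_reals_def by blast
  show ?thesis
  proof
    show "min (t - a) (b - t) > 0" using ab by simp
    show "inj_on (\<lambda>x. F (complex_of_real x)) {t - min (t - a) (b - t)<..<t + min (t - a) (b - t)}"
      by (rule inj_on_subset[OF ab(3)]) auto
  qed
qed

lemma isCont_F_real: "isCont (\<lambda>x. F (complex_of_real x)) t"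
proof -
  have "F analytic_on {complex_of_real t}"
    by (rule analytic_on_subset[OF analytic]) auto
  then have "isCont F (complex_of_real t)"
    by (rule analytic_at_imp_isCont)
  then show ?thesis
    by (intro continuous_at_compose[of _ complex_of_real F, unfolded o_def] continuous_intros) auto
qed

text \<open>Continuity passes the equality of values to the limit. A limit on the diagonal is
  excluded, since two distinct points with equal values would enter an interval of
  injectivity.\<close>

lemma limpt_selfint_mem:
  assumes "(a, b) islimpt selfint"
  shows "(a, b) \<in> selfint"
proof -
  obtain p where p: "\<And>n. p n \<in> selfint - {(a, b)}" "p \<longlonglongrightarrow> (a, b)"
    using assms unfolding islimpt_sequential by blast
  have lim: "(\<lambda>n. fst (p n)) \<longlonglongrightarrow> a" "(\<lambda>n. snd (p n)) \<longlonglongrightarrow> b"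
    using tendsto_fst[OF p(2)] tendsto_snd[OF p(2)] by simp_all
  have p_selfint: "fst (p n) \<noteq> snd (p n)" "F (complex_of_real (fst (p n))) = F (complex_of_real (snd (p n)))" for n
    using p(1)[of n] by (auto simp: selfint_def)
  have "(\<lambda>n. F (complex_of_real (fst (p n)))) \<longlonglongrightarrow> F (complex_of_real a)"
    using isCont_tendsto_compose[OF isCont_F_real lim(1)] .
  moreover have "(\<lambda>n. F (complex_of_real (fst (p n)))) \<longlonglongrightarrow> F (complex_of_real b)"
    using isCont_tendsto_compose[OF isCont_F_real lim(2)] p_selfint(2) by simp
  ultimately have "F (complex_of_real a) = F (complex_of_real b)"
    by (rule LIMSEQ_unique)
  moreover have "a \<noteq> b"
  proof
    assume "a = b"
    obtain d where d: "d > 0" "inj_on (\<lambda>x. F (complex_of_real x)) {a - d<..<a + d}"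
      by (rule injective_nhd)
    have "\<forall>\<^sub>F n in sequentially. fst (p n) \<in> {a - d<..<a + d}"
      "\<forall>\<^sub>F n in sequentially. snd (p n) \<in> {a - d<..<a + d}"
      using lim \<open>a = b\<close> d(1) by (intro topological_tendstoD[where l = a]; simp)+
    then have "\<forall>\<^sub>F n in sequentially. False"
    proof eventually_elim
      case (elim n)
      then show ?case
        using inj_onD[OF d(2) p_selfint(2)[of n]] p_selfint(1)[of n] by blast
    qed
    then show False by simp
  qed
  ultimately show ?thesis by (simp add: selfint_def)
qed

text \<open>Move both points to the origin, take an odd real branch of \<open>G a x = G b y\<close>,
  and invert its parametrisation of \<open>x\<close> by the real \<open>n\<close>-th root.\<close>

lemma local_graph:
  assumes lim: "(a, b) islimpt selfint"
  obtains \<phi> d where "d > 0" "continuous_on {a - d<..<a + d} \<phi>" "\<phi> a = b" "inj_on \<phi> {a - d<..<a + d}"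
    "\<And>x. x \<in> {a - d<..<a + d} \<Longrightarrow> F (complex_of_real (\<phi> x)) = F (complex_of_real x)"
proof -
  have Fab: "F (complex_of_real a) = F (complex_of_real b)"
    using limpt_selfint_mem[OF lim] by (simp add: selfint_def)
  define c where "c = F (complex_of_real a)"
  \<comment> \<open>As \<open>F\<close> has the common value \<open>c\<close> at \<open>a\<close>
    and \<open>b\<close>, both translates \<open>G a\<close> and \<open>G b\<close> vanish at the
    origin.\<close>
  define G where "G = (\<lambda>t z. F (complex_of_real t + z) - c)"
  have hol: "\<exists>r>0. G t holomorphic_on ball 0 r" for t
  proof -
    obtain r where "r > 0" "F holomorphic_on ball (complex_of_real t) r"
      using analytic unfolding analytic_on_def by (meson Reals_of_real)
    then show ?thesis
      unfolding G_def
      by (intro exI[of _ r] conjI holomorphic_intros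
          holomorphic_on_compose_gen[of _ "ball 0 r" F "ball (complex_of_real t) r", unfolded o_def])
        (auto simp: dist_norm)
  qed
  obtain ra rb where rab: "ra > 0" "G a holomorphic_on ball 0 ra" "rb > 0" "G b holomorphic_on ball 0 rb"
    using hol by metis
  define r where "r = min ra rb"
  have "r > 0" using rab by (simp add: r_def)
  have hol': "G a holomorphic_on ball 0 r" "G b holomorphic_on ball 0 r"
    using rab(2,4) by (auto simp: r_def intro: holomorphic_on_subset)
  have inj: "inj_on (\<lambda>x. G t (complex_of_real x)) {- d<..<d}"
    if "inj_on (\<lambda>x. F (complex_of_real x)) {t - d<..<t + d}" for t d
  proof (rule inj_onI)
    fix x y assume "x \<in> {- d<..<d}" "y \<in> {- d<..<d}" "G t (complex_of_real x) = G t (complex_of_real y)"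
    then show "x = y"
      using inj_onD[OF that, of "t + x" "t + y"] by (simp add: G_def)
  qed
  obtain da where da: "da > 0" "inj_on (\<lambda>x. F (complex_of_real x)) {a - da<..<a + da}"
    by (rule injective_nhd)
  obtain db where db: "db > 0" "inj_on (\<lambda>x. F (complex_of_real x)) {b - db<..<b + db}"
    by (rule injective_nhd)
  have nonconst: "\<not> G t constant_on ball 0 r"
    if "d > 0" "inj_on (\<lambda>x. F (complex_of_real x)) {t - d<..<t + d}" for t d
  proof
    assume "G t constant_on ball 0 r"
    then obtain k where k: "\<And>z. z \<in> ball 0 r \<Longrightarrow> G t z = k"
      unfolding constant_on_def by blast
    define x where "x = min d r / 2"
    have x: "0 < x" "x < d" "x < r"
      using \<open>d > 0\<close> \<open>r > 0\<close> by (auto simp: x_def min_def)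
    have "G t (complex_of_real x) = G t (complex_of_real 0)"
      using x k by simp
    then show False
      using inj_onD[OF inj[OF that(2)], of x 0] x by simp
  qed
  define X where "X = {(x, y). x \<noteq> 0 \<and> G a (complex_of_real x) = G b (complex_of_real y)}"
  have "(0, 0) islimpt X"
    unfolding islimpt_approachable
  proof (intro allI impI)
    fix \<epsilon> :: real assume "\<epsilon> > 0"
    then obtain x y where xy: "(x, y) \<in> selfint" "(x, y) \<noteq> (a, b)" "dist (x, y) (a, b) < min \<epsilon> db"
      using lim db(1) unfolding islimpt_approachable by (metis min_less_iff_conj surj_pair)
    have Fxy: "F (complex_of_real x) = F (complex_of_real y)"
      using xy(1) by (simp add: selfint_def)
    have "dist y b < db"
      using dist_snd_le[of "(x, y)" "(a, b)"] xy(3) by simp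
    then have "y \<in> {b - db<..<b + db}" by (auto simp: dist_real_def)
    \<comment> \<open>\<open>F\<close> is injective on an interval about \<open>b\<close> containing
      \<open>y\<close>, so a pair with first coordinate \<open>a\<close> could only be
      \<open>(a, b)\<close> itself.\<close>
    have "x \<noteq> a"
    proof
      assume "x = a"
      then have "y = b"
        using inj_onD[OF db(2), of y b] Fxy Fab \<open>y \<in> _\<close> db(1) by simp
      then show False using xy(2) \<open>x = a\<close> by simp
    qed
    then have "(x - a, y - b) \<in> X"
      using Fxy by (simp add: X_def G_def)
    moreover have "dist (x - a, y - b) (0, 0) < \<epsilon>"
      using xy(3) by (simp add: dist_prod_def dist_real_def)
    ultimately show "\<exists>x'\<in>X. x' \<noteq> (0, 0) \<and> dist x' (0, 0) < \<epsilon>"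
      using \<open>x \<noteq> a\<close> by (intro bexI[of _ "(x - a, y - b)"]) auto
  qed
  moreover have "G a 0 = 0" "G b 0 = 0"
    using Fab by (simp_all add: G_def c_def)
  ultimately obtain l where l: "l > 0" "real_branch (G a) (G b) l"
    using real_branch_exists[OF hol'(1) _ nonconst[OF da] hol'(2) _ nonconst[OF db] \<open>r > 0\<close>, of X]
    unfolding X_def by blast
  obtain n where n: "odd n" "real_branch (G a) (G b) n"
    using real_branch_odd[OF l(2,1) inj[OF db(2)] db(1)] by blast
  then obtain \<sigma> e \<psi> where \<sigma>: "\<sigma> \<in> {1, - 1 :: complex}" and "e > 0" and \<psi>: "\<psi> holomorphic_on ball 0 e"
    and \<psi>0: "\<psi> 0 = 0" and real: "\<And>t. t \<in> \<real> \<inter> ball 0 e \<Longrightarrow> \<psi> t \<in> \<real>"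
    and eq: "\<And>t. t \<in> ball 0 e \<Longrightarrow> G b (\<psi> t) = G a (\<sigma> * t ^ n)"
    unfolding real_branch_def by blast
  define s where "s = Re \<sigma>"
  have s: "\<sigma> = complex_of_real s" "s * s = 1"
    using \<sigma> by (auto simp: s_def)
  \<comment> \<open>Odd \<open>n\<close> lets \<open>root\<close> invert the power at negative
    arguments too, and \<open>s * s = 1\<close> then gives
    \<open>s * \<tau> x ^ n = x - a\<close>.\<close>
  define \<tau> where "\<tau> = (\<lambda>x. root n (s * (x - a)))"
  have \<tau>: "continuous_on UNIV \<tau>" "\<tau> a = 0"
    unfolding \<tau>_def by (intro continuous_intros) auto
  have \<tau>n: "s * \<tau> x ^ n = x - a" for x
    using s(2) n(1) by (simp add: \<tau>_def odd_real_root_pow flip: mult.assoc)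
  have "isCont \<tau> a"
    using \<tau>(1) by (simp add: continuous_on_eq_continuous_at)
  then obtain d0 where d0: "d0 > 0" "\<And>x. dist x a < d0 \<Longrightarrow> dist (\<tau> x) 0 < e"
    using \<open>e > 0\<close> \<tau>(2) unfolding continuous_at_eps_delta by metis
  define d where "d = min d0 da"
  have d: "d > 0" "d \<le> d0" "d \<le> da" using d0(1) da(1) by (auto simp: d_def)
  have \<tau>_in: "complex_of_real (\<tau> x) \<in> \<real> \<inter> ball 0 e" if "x \<in> {a - d<..<a + d}" for x
    using d0(2)[of x] that d by (auto simp: dist_real_def)
  define \<phi> where "\<phi> = (\<lambda>x. b + Re (\<psi> (complex_of_real (\<tau> x))))"
  have \<phi>F: "F (complex_of_real (\<phi> x)) = F (complex_of_real x)" if x: "x \<in> {a - d<..<a + d}" for x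
  proof -
    have "complex_of_real (Re (\<psi> (complex_of_real (\<tau> x)))) = \<psi> (complex_of_real (\<tau> x))"
      using real[OF \<tau>_in[OF x]] by simp
    moreover have "\<sigma> * complex_of_real (\<tau> x) ^ n = complex_of_real (x - a)"
      using \<tau>n[of x] s(1) by (metis of_real_mult of_real_power)
    ultimately show ?thesis
      using eq[of "complex_of_real (\<tau> x)"] \<tau>_in[OF x] by (simp add: G_def \<phi>_def)
  qed
  show ?thesis
  proof
    show "continuous_on {a - d<..<a + d} \<phi>"
      unfolding \<phi>_def using \<tau>_in
      by (intro continuous_intros continuous_on_compose2[OF holomorphic_on_imp_continuous_on[OF \<psi>]]
          continuous_on_subset[OF \<tau>(1)]) auto
    \<comment> \<open>\<open>F\<close> after \<open>\<phi>\<close> is \<open>F\<close>, so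
      \<open>\<phi>\<close> inherits the injectivity of \<open>F\<close> near \<open>a\<close>; this
      is why \<open>d\<close> is at most \<open>da\<close>.\<close>
    show "inj_on \<phi> {a - d<..<a + d}"
    proof (rule inj_onI)
      fix x y assume xy: "x \<in> {a - d<..<a + d}" "y \<in> {a - d<..<a + d}" "\<phi> x = \<phi> y"
      then have "F (complex_of_real x) = F (complex_of_real y)"
        using \<phi>F by metis
      then show "x = y"
        using inj_onD[OF da(2), of x y] xy d by auto
    qed
  qed (use d \<phi>F \<tau>(2) \<psi>0 in \<open>auto simp: \<phi>_def\<close>)
qed

text \<open>The set of self-intersections is locally increasing (\<open>s = 1\<close>) or decreasing (\<open>s = - 1\<close>). Stated for
  the set rather than for a parametrizing function, this is an open and closed condition on its limit
  points, so branches can be continued without gluing functions.\<close>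

definition mono_at :: "real \<Rightarrow> real \<Rightarrow> real \<Rightarrow> bool" where
  "mono_at s a b \<longleftrightarrow> (\<exists>e>0. \<forall>x y x' y'. (x, y) \<in> selfint \<longrightarrow> (x', y') \<in> selfint \<longrightarrow>
     \<bar>x - a\<bar> < e \<longrightarrow> \<bar>y - b\<bar> < e \<longrightarrow> \<bar>x' - a\<bar> < e \<longrightarrow> \<bar>y' - b\<bar> < e \<longrightarrow> (x < x' \<longleftrightarrow> s * y < s * y'))"

text \<open>Near the limit point the set is the graph of \<open>\<phi>\<close>, and a continuous
  injection of an interval is strictly monotone. For the second claim, the graph is connected with
  more than one point, so all its points are limit points.\<close>

lemma limpt_selfint_local_structure:
  assumes lim: "(a, b) islimpt selfint"
  shows "\<exists>s\<in>{1, - 1}. mono_at s a b"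
    and "\<eta> > 0 \<Longrightarrow> \<exists>\<delta>>0. \<forall>x. \<bar>x - a\<bar> < \<delta> \<longrightarrow> (\<exists>y. \<bar>y - b\<bar> < \<eta> \<and> (x, y) islimpt selfint)"
proof -
  obtain \<phi> d where \<phi>: "d > 0" "continuous_on {a - d<..<a + d} \<phi>" "\<phi> a = b" "inj_on \<phi> {a - d<..<a + d}"
    "\<And>x. x \<in> {a - d<..<a + d} \<Longrightarrow> F (complex_of_real (\<phi> x)) = F (complex_of_real x)"
    using local_graph[OF lim] by metis
  have "isCont \<phi> a"
    using \<phi>(1,2) by (simp add: continuous_on_eq_continuous_at)
  then have small: "\<exists>\<delta>>0. \<delta> \<le> d \<and> (\<forall>x. \<bar>x - a\<bar> < \<delta> \<longrightarrow> \<bar>\<phi> x - b\<bar> < \<eta>)" if "\<eta> > 0" for \<eta>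
  proof -
    obtain \<delta> where "\<delta> > 0" "\<And>x. dist x a < \<delta> \<Longrightarrow> dist (\<phi> x) b < \<eta>"
      using \<open>isCont \<phi> a\<close> \<open>\<eta> > 0\<close> \<phi>(3) unfolding continuous_at_eps_delta by metis
    then show ?thesis
      using \<phi>(1) by (intro exI[of _ "min \<delta> d"]) (auto simp: dist_real_def)
  qed
  show "\<exists>s\<in>{1, - 1}. mono_at s a b"
  proof -
    obtain q where q: "q > 0" "inj_on (\<lambda>x. F (complex_of_real x)) {b - q<..<b + q}"
      by (rule injective_nhd)
    obtain \<delta> where \<delta>: "\<delta> > 0" "\<delta> \<le> d" "\<And>x. \<bar>x - a\<bar> < \<delta> \<Longrightarrow> \<bar>\<phi> x - b\<bar> < q"
      using small[OF q(1)] by blast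
    define e where "e = min \<delta> q"
    have e: "e > 0" using \<delta> q by (simp add: e_def)
    \<comment> \<open>\<open>y\<close> and \<open>\<phi> x\<close> have the same value under
      \<open>F\<close> and lie in one interval of injectivity about \<open>b\<close>.\<close>
    have graph: "y = \<phi> x" if "(x, y) \<in> selfint" "\<bar>x - a\<bar> < e" "\<bar>y - b\<bar> < e" for x y
    proof (rule inj_onD[OF q(2)])
      show "F (complex_of_real y) = F (complex_of_real (\<phi> x))"
        using that \<phi>(5)[of x] \<delta>(2) by (simp add: selfint_def e_def abs_less_iff)
      show "y \<in> {b - q<..<b + q}" "\<phi> x \<in> {b - q<..<b + q}"
        using that \<delta>(3)[of x] by (auto simp: e_def)
    qed
    consider "strict_mono_on {a - d<..<a + d} \<phi>" | "strict_antimono_on {a - d<..<a + d} \<phi>"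
      using injective_eq_monotone_map[of "{a - d<..<a + d}" \<phi>] \<phi>(2,4) is_interval_oo by blast
    then show ?thesis
    proof cases
      case 1
      have "x < x' \<longleftrightarrow> \<phi> x < \<phi> x'" if "\<bar>x - a\<bar> < e" "\<bar>x' - a\<bar> < e" for x x'
        using strict_mono_on_less[OF 1, of x x'] that \<delta>(2) by (simp add: e_def abs_less_iff)
      note less = this
      have "mono_at 1 a b"
        unfolding mono_at_def
      proof (intro exI[of _ e] conjI allI impI)
        fix x y x' y' assume "(x, y) \<in> selfint" "(x', y') \<in> selfint" "\<bar>x - a\<bar> < e" "\<bar>y - b\<bar> < e"
          "\<bar>x' - a\<bar> < e" "\<bar>y' - b\<bar> < e"
        then show "x < x' \<longleftrightarrow> 1 * y < 1 * y'"
          using less[of x x'] graph by simp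
      qed (rule e)
      then show ?thesis by blast
    next
      case 2
      then have "strict_mono_on {a - d<..<a + d} (\<lambda>x. - \<phi> x)"
        by (auto simp: monotone_on_def)
      then have "x < x' \<longleftrightarrow> - \<phi> x < - \<phi> x'" if "\<bar>x - a\<bar> < e" "\<bar>x' - a\<bar> < e" for x x'
        using strict_mono_on_less[of _ "\<lambda>x. - \<phi> x" x x'] that \<delta>(2) by (simp add: e_def abs_less_iff)
      note less = this
      have "mono_at (- 1) a b"
        unfolding mono_at_def
      proof (intro exI[of _ e] conjI allI impI)
        fix x y x' y' assume "(x, y) \<in> selfint" "(x', y') \<in> selfint" "\<bar>x - a\<bar> < e" "\<bar>y - b\<bar> < e"
          "\<bar>x' - a\<bar> < e" "\<bar>y' - b\<bar> < e"
        then show "x < x' \<longleftrightarrow> - 1 * y < - 1 * y'"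
          using less[of x x'] graph by simp
      qed (rule e)
      then show ?thesis by blast
    qed
  qed
  show "\<exists>\<delta>>0. \<forall>x. \<bar>x - a\<bar> < \<delta> \<longrightarrow> (\<exists>y. \<bar>y - b\<bar> < \<eta> \<and> (x, y) islimpt selfint)" if "\<eta> > 0"
  proof -
    have "a \<noteq> b" using limpt_selfint_mem[OF lim] by (simp add: selfint_def)
    \<comment> \<open>Moving each coordinate by less than half of \<open>\<bar>a - b\<bar>\<close>
      keeps the graph off the diagonal, so that it consists of self-intersections.\<close>
    then obtain \<delta>0 where \<delta>0: "\<delta>0 > 0" "\<delta>0 \<le> d" "\<And>x. \<bar>x - a\<bar> < \<delta>0 \<Longrightarrow> \<bar>\<phi> x - b\<bar> < min \<eta> (\<bar>a - b\<bar> / 2)"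
      using small[of "min \<eta> (\<bar>a - b\<bar> / 2)"] \<open>\<eta> > 0\<close> by auto
    define \<delta> where "\<delta> = min \<delta>0 (\<bar>a - b\<bar> / 2)"
    have \<delta>: "\<delta> > 0" using \<delta>0 \<open>a \<noteq> b\<close> by (simp add: \<delta>_def)
    define \<Gamma> where "\<Gamma> = (\<lambda>x. (x, \<phi> x)) ` {a - \<delta><..<a + \<delta>}"
    have "\<Gamma> \<subseteq> selfint"
    proof
      fix p assume "p \<in> \<Gamma>"
      then obtain x where x: "p = (x, \<phi> x)" "\<bar>x - a\<bar> < \<delta>" by (auto simp: \<Gamma>_def)
      then have "\<bar>\<phi> x - b\<bar> < \<bar>a - b\<bar> / 2" "\<bar>x - a\<bar> < \<bar>a - b\<bar> / 2" "\<bar>x - a\<bar> < d"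
        using \<delta>0(2) \<delta>0(3)[of x] by (auto simp: \<delta>_def)
      then have "x \<noteq> \<phi> x" "F (complex_of_real (\<phi> x)) = F (complex_of_real x)"
        using \<phi>(5)[of x] by (auto simp: abs_if split: if_splits)
      then show "p \<in> selfint" using x by (simp add: selfint_def)
    qed
    have "connected \<Gamma>"
      unfolding \<Gamma>_def
    proof (intro connected_continuous_image continuous_intros)
      show "continuous_on {a - \<delta><..<a + \<delta>} \<phi>"
        using \<delta>0(2) by (intro continuous_on_subset[OF \<phi>(2)]) (auto simp: \<delta>_def)
    qed auto
    moreover have "\<Gamma> \<noteq> {p}" for p
    proof -
      have "(a, \<phi> a) \<in> \<Gamma>" "(a + \<delta> / 2, \<phi> (a + \<delta> / 2)) \<in> \<Gamma>"
        using \<delta> by (auto simp: \<Gamma>_def)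
      then show ?thesis using \<delta> by auto
    qed
    ultimately have limpt_\<Gamma>: "p islimpt selfint" if "p \<in> \<Gamma>" for p
      using connected_imp_perfect[OF _ that] islimpt_subset[OF _ \<open>\<Gamma> \<subseteq> selfint\<close>] by blast
    have "\<bar>\<phi> x - b\<bar> < \<eta> \<and> (x, \<phi> x) islimpt selfint" if "\<bar>x - a\<bar> < \<delta>" for x
    proof -
      have "(x, \<phi> x) \<in> \<Gamma>"
        using that unfolding \<Gamma>_def by (intro imageI) (auto simp: abs_less_iff)
      moreover have "\<bar>\<phi> x - b\<bar> < \<eta>"
        using \<delta>0(3)[of x] that by (simp add: \<delta>_def)
      ultimately show ?thesis
        using limpt_\<Gamma> by blast
    qed
    then show ?thesis using \<delta> by blast
  qed
qed

section \<open>Openness and closedness of the monotonicity type\<close>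

text \<open>The window of size \<open>e\<close> at \<open>(a, b)\<close> contains the window of size
  \<open>e / 2\<close> at every point within \<open>e / 2\<close> in both coordinates, so the sign
  is inherited. Both centres are self-intersections in the large window, which orders them.\<close>

lemma mono_at_extend:
  assumes lim: "(a, b) islimpt selfint" and mono: "mono_at s a b" and "\<eta> > 0"
  shows "\<exists>\<delta>>0. \<forall>x. \<bar>x - a\<bar> < \<delta> \<longrightarrow> (\<exists>y. \<bar>y - b\<bar> < \<eta> \<and> (x, y) islimpt selfint \<and> mono_at s x y \<and>
           (a < x \<longleftrightarrow> s * b < s * y) \<and> (x < a \<longleftrightarrow> s * y < s * b))"
proof -
  obtain e where e: "e > 0" "\<And>x y x' y'. (x, y) \<in> selfint \<Longrightarrow> (x', y') \<in> selfint \<Longrightarrow>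
     \<bar>x - a\<bar> < e \<Longrightarrow> \<bar>y - b\<bar> < e \<Longrightarrow> \<bar>x' - a\<bar> < e \<Longrightarrow> \<bar>y' - b\<bar> < e \<Longrightarrow> x < x' \<longleftrightarrow> s * y < s * y'"
    using mono unfolding mono_at_def by blast
  have "min \<eta> (e / 2) > 0" using e \<open>\<eta> > 0\<close> by simp
  then obtain \<delta> where \<delta>: "\<delta> > 0"
    "\<And>x. \<bar>x - a\<bar> < \<delta> \<Longrightarrow> \<exists>y. \<bar>y - b\<bar> < min \<eta> (e / 2) \<and> (x, y) islimpt selfint"
    using limpt_selfint_local_structure(2)[OF lim] by blast
  have "\<exists>y. \<bar>y - b\<bar> < \<eta> \<and> (x, y) islimpt selfint \<and> mono_at s x y \<and>
           (a < x \<longleftrightarrow> s * b < s * y) \<and> (x < a \<longleftrightarrow> s * y < s * b)"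
    if x: "\<bar>x - a\<bar> < min \<delta> (e / 2)" for x
  proof -
    obtain y where y: "\<bar>y - b\<bar> < min \<eta> (e / 2)" "(x, y) islimpt selfint"
      using \<delta>(2)[of x] x by auto
    have "mono_at s x y"
      unfolding mono_at_def
    proof (intro exI[of _ "e / 2"] conjI allI impI)
      fix u v u' v' assume "(u, v) \<in> selfint" "(u', v') \<in> selfint" "\<bar>u - x\<bar> < e / 2" "\<bar>v - y\<bar> < e / 2"
        "\<bar>u' - x\<bar> < e / 2" "\<bar>v' - y\<bar> < e / 2"
      moreover from this have "\<bar>u - a\<bar> < e" "\<bar>v - b\<bar> < e" "\<bar>u' - a\<bar> < e" "\<bar>v' - b\<bar> < e"
        using x y(1) by linarith+
      ultimately show "u < u' \<longleftrightarrow> s * v < s * v'"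
        using e(2) by blast
    qed (use e in simp)
    moreover have "a < x \<longleftrightarrow> s * b < s * y" "x < a \<longleftrightarrow> s * y < s * b"
      using e limpt_selfint_mem[OF y(2)] limpt_selfint_mem[OF lim] x y(1) by auto
    ultimately show ?thesis using y by auto
  qed
  moreover have "min \<delta> (e / 2) > 0" using \<delta>(1) e(1) by simp
  ultimately show ?thesis by blast
qed

text \<open>Limit points form a closed set, and the limit has some sign \<open>s'\<close>. Were it
  opposite to \<open>s\<close>, a late \<open>(X n, Y n)\<close> and another self-intersection close
  to it would be ordered in both ways.\<close>

lemma mono_at_closed:
  assumes XY: "\<And>n. (X n, Y n) islimpt selfint" "\<And>n. mono_at s (X n) (Y n)"
    and lim: "X \<longlonglongrightarrow> a" "Y \<longlonglongrightarrow> b" and s: "s \<in> {1, - 1}"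
  shows "(a, b) islimpt selfint" "mono_at s a b"
proof -
  have "closed {p. p islimpt selfint}"
    by (simp add: closed_limpts)
  moreover have "(\<lambda>n. (X n, Y n)) \<longlonglongrightarrow> (a, b)"
    by (intro tendsto_Pair lim)
  ultimately show ab: "(a, b) islimpt selfint"
    using XY(1) closed_sequentially[of "{p. p islimpt selfint}" "\<lambda>n. (X n, Y n)" "(a, b)"] by simp
  obtain s' where s': "s' \<in> {1, - 1}" "mono_at s' a b"
    using limpt_selfint_local_structure(1)[OF ab] by blast
  have "s' = s"
  proof (rule ccontr)
    assume "s' \<noteq> s"
    then have "s' = - s" using s s'(1) by auto
    obtain e where e: "e > 0" "\<And>x y x' y'. (x, y) \<in> selfint \<Longrightarrow> (x', y') \<in> selfint \<Longrightarrow>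
       \<bar>x - a\<bar> < e \<Longrightarrow> \<bar>y - b\<bar> < e \<Longrightarrow> \<bar>x' - a\<bar> < e \<Longrightarrow> \<bar>y' - b\<bar> < e \<Longrightarrow> x < x' \<longleftrightarrow> s' * y < s' * y'"
      using s'(2) unfolding mono_at_def by blast
    have "\<forall>\<^sub>F n in sequentially. dist (X n) a < e / 2" "\<forall>\<^sub>F n in sequentially. dist (Y n) b < e / 2"
      using tendstoD[OF lim(1), of "e / 2"] tendstoD[OF lim(2), of "e / 2"] e(1) by simp_all
    then have "\<forall>\<^sub>F n in sequentially. dist (X n) a < e / 2 \<and> dist (Y n) b < e / 2"
      by (rule eventually_conj)
    then obtain n where n: "\<bar>X n - a\<bar> < e / 2" "\<bar>Y n - b\<bar> < e / 2"
      unfolding dist_real_def by (auto dest: eventually_happens)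
    obtain q where q: "q > 0" "\<And>x y x' y'. (x, y) \<in> selfint \<Longrightarrow> (x', y') \<in> selfint \<Longrightarrow>
       \<bar>x - X n\<bar> < q \<Longrightarrow> \<bar>y - Y n\<bar> < q \<Longrightarrow> \<bar>x' - X n\<bar> < q \<Longrightarrow> \<bar>y' - Y n\<bar> < q \<Longrightarrow> x < x' \<longleftrightarrow> s * y < s * y'"
      using XY(2)[of n] unfolding mono_at_def by blast
    have "min q (e / 2) > 0" using q e by simp
    then obtain x y where xy: "(x, y) \<in> selfint" "(x, y) \<noteq> (X n, Y n)" "dist (x, y) (X n, Y n) < min q (e / 2)"
      using XY(1)[of n] unfolding islimpt_approachable by (metis surj_pair)
    have close: "\<bar>x - X n\<bar> < min q (e / 2)" "\<bar>y - Y n\<bar> < min q (e / 2)"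
      using dist_fst_le[of "(x, y)" "(X n, Y n)"] dist_snd_le[of "(x, y)" "(X n, Y n)"] xy(3)
      by (simp_all add: dist_real_def)
    then have close': "\<bar>x - a\<bar> < e" "\<bar>y - b\<bar> < e" "\<bar>X n - a\<bar> < e" "\<bar>Y n - b\<bar> < e"
      using n e(1) by linarith+
    have XY_mem: "(X n, Y n) \<in> selfint" by (rule limpt_selfint_mem[OF XY(1)])
    have "x < X n \<longleftrightarrow> s * y < s * Y n" "X n < x \<longleftrightarrow> s * Y n < s * y"
      using q(2)[OF xy(1) XY_mem] q(2)[OF XY_mem xy(1)] close q(1) by auto
    moreover have "x < X n \<longleftrightarrow> s' * y < s' * Y n" "X n < x \<longleftrightarrow> s' * Y n < s' * y"
      using e(2)[OF xy(1) XY_mem] e(2)[OF XY_mem xy(1)] close' by auto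
    \<comment> \<open>With opposite signs the equivalences leave no strict inequality in either
      coordinate, so \<open>(x, y)\<close> would be \<open>(X n, Y n)\<close>.\<close>
    ultimately show False
      using \<open>s' = - s\<close> s xy(2) by auto
  qed
  then show "mono_at s a b" using s'(2) by simp
qed

text \<open>The second coordinates lie in a compact interval, so a subsequence of them converges and
  closedness of the type applies. The set \<open>C\<close> carries a further closed condition to the
  limit, later a side of the diagonal.\<close>

lemma mono_at_closed_bounded:
  assumes "X \<longlonglongrightarrow> t" and s: "s \<in> {1, - 1}" and C: "closed C"
    and Y: "\<And>n. \<exists>y\<in>{lo..hi}. (X n, y) \<in> C \<and> (X n, y) islimpt selfint \<and> mono_at s (X n) y"
  shows "\<exists>y\<in>{lo..hi}. (t, y) \<in> C \<and> (t, y) islimpt selfint \<and> mono_at s t y"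
proof -
  obtain Y where Y: "\<And>n. Y n \<in> {lo..hi}" "\<And>n. (X n, Y n) \<in> C" "\<And>n. (X n, Y n) islimpt selfint"
    "\<And>n. mono_at s (X n) (Y n)"
    using Y by metis
  have "seq_compact {lo..hi}"
    by (simp add: compact_imp_seq_compact)
  then obtain y r where y: "y \<in> {lo..hi}" "strict_mono r" "(Y \<circ> r) \<longlonglongrightarrow> y"
    using Y(1) by (meson seq_compactE)
  have Xr: "(X \<circ> r) \<longlonglongrightarrow> t"
    using assms(1) y(2) by (rule LIMSEQ_subseq_LIMSEQ)
  have "(\<lambda>n. ((X \<circ> r) n, (Y \<circ> r) n)) \<longlonglongrightarrow> (t, y)"
    by (intro tendsto_Pair Xr y)
  then have "(t, y) \<in> C"
    using closed_sequentially[OF C, of "\<lambda>n. ((X \<circ> r) n, (Y \<circ> r) n)" "(t, y)"] Y(2) by simp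
  moreover have "(t, y) islimpt selfint" "mono_at s t y"
    using mono_at_closed[OF _ _ Xr y(3) s] Y(3,4) by simp_all
  ultimately show ?thesis using y(1) by blast
qed

section \<open>Following branches to the right\<close>

text \<open>Along the branch \<open>y\<close> falls as \<open>x\<close> grows, so it stays at most
  \<open>b\<close>, and it cannot cross the diagonal, which contains no limit points. Continued as
  far as \<open>x = b\<close>, the branch would need \<open>b < y\<close> and
  \<open>y \<le> b\<close>.\<close>

lemma decreasing_impossible:
  assumes "a < b" "(a, b) islimpt selfint" "mono_at (- 1) a b"
  shows False
proof -
  define Q where "Q = (\<lambda>x. \<exists>y. x < y \<and> y \<le> b \<and> (x, y) islimpt selfint \<and> mono_at (- 1) x y)"
  have "Q b"
  proof (rule real_interval_induct[of Q a])
    show "Q a" "a \<le> b" using assms by (auto simp: Q_def)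
  next
    fix t assume "a \<le> t" "Q t"
    then obtain y where y: "t < y" "y \<le> b" "(t, y) islimpt selfint" "mono_at (- 1) t y"
      by (auto simp: Q_def)
    \<comment> \<open>Half the gap: \<open>x < t + \<eta>\<close> and \<open>y - \<eta> < y'\<close>
      give \<open>x < y'\<close>, as both bounds are the midpoint of \<open>t\<close> and
      \<open>y\<close>.\<close>
    define \<eta> where "\<eta> = (y - t) / 2"
    have "\<eta> > 0" using y(1) by (simp add: \<eta>_def)
    obtain \<delta> where \<delta>: "\<delta> > 0" "\<And>x. \<bar>x - t\<bar> < \<delta> \<Longrightarrow> \<exists>y'. \<bar>y' - y\<bar> < \<eta> \<and> (x, y') islimpt selfint \<and>
        mono_at (- 1) x y' \<and> (t < x \<longleftrightarrow> - 1 * y < - 1 * y')"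
      using mono_at_extend[OF y(3,4) \<open>\<eta> > 0\<close>] by meson
    have "Q x" if "t < x" "x < t + min \<delta> \<eta>" for x
    proof -
      have near: "\<bar>x - t\<bar> < \<delta>" and near': "x < t + \<eta>"
        using that by linarith+
      obtain y' where y': "\<bar>y' - y\<bar> < \<eta>" "(x, y') islimpt selfint" "mono_at (- 1) x y'" "y' < y"
        using \<delta>(2)[OF near] \<open>t < x\<close> by auto
      moreover have "x < y'"
        using y'(1) near' unfolding \<eta>_def by (simp add: abs_if field_simps split: if_splits)
      ultimately show ?thesis
        using y(2) unfolding Q_def by (intro exI[of _ y']) auto
    qed
    then show "\<exists>d>0. \<forall>x. t < x \<and> x < t + d \<longrightarrow> Q x"
      using \<delta>(1) \<open>\<eta> > 0\<close> by (intro exI[of _ "min \<delta> \<eta>"]) auto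
  next
    fix t assume t: "a < t" "\<forall>x. a \<le> x \<and> x < t \<longrightarrow> Q x"
    obtain X where X: "\<And>n. a < X n" "\<And>n. X n < t" "X \<longlonglongrightarrow> t"
      using sequence_strictly_below[OF t(1)] by blast
    have s_mem: "- 1 \<in> {1, - 1 :: real}" by simp
    \<comment> \<open>Only the weak inequality survives the limit; strictness returns because no
      limit point lies on the diagonal.\<close>
    have "closed {p::real\<times>real. fst p \<le> snd p}"
      by (intro closed_Collect_le continuous_intros)
    moreover have "\<exists>y\<in>{a..b}. (X n, y) \<in> {p. fst p \<le> snd p} \<and> (X n, y) islimpt selfint \<and> mono_at (- 1) (X n) y" for n
    proof -
      have "Q (X n)" using t(2) X(1)[of n] X(2)[of n] by (simp add: less_imp_le)
      then obtain y where "X n < y" "y \<le> b" "(X n, y) islimpt selfint" "mono_at (- 1) (X n) y"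
        unfolding Q_def by blast
      then show ?thesis using X(1)[of n] by (intro bexI[of _ y]) auto
    qed
    ultimately obtain y where y: "y \<in> {a..b}" "(t, y) \<in> {p. fst p \<le> snd p}" "(t, y) islimpt selfint" "mono_at (- 1) t y"
      using mono_at_closed_bounded[OF X(3) s_mem, where C = "{p. fst p \<le> snd p}" and lo = a and hi = b] by blast
    moreover have "t \<noteq> y" using limpt_selfint_mem[OF y(3)] by (simp add: selfint_def)
    ultimately show "Q t" unfolding Q_def by force
  qed
  then show False by (auto simp: Q_def)
qed

text \<open>Along the branch \<open>y\<close> grows with \<open>x\<close>, so it stays at least
  \<open>a\<close>, and it remains below \<open>x\<close> because it cannot cross the diagonal. Over
  bounded \<open>x\<close> it is therefore confined to a compact interval and continues to every
  \<open>x \<ge> b\<close>.\<close>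

lemma increasing_right:
  assumes "a < b" "(b, a) islimpt selfint" "mono_at 1 b a" "b \<le> x"
  shows "\<exists>y. a \<le> y \<and> y < x \<and> F (complex_of_real y) = F (complex_of_real x)"
proof -
  define Q where "Q = (\<lambda>x. \<exists>y. a \<le> y \<and> y < x \<and> (x, y) islimpt selfint \<and> mono_at 1 x y)"
  have "Q x"
  proof (rule real_interval_induct[of Q b])
    show "Q b" "b \<le> x" using assms by (auto simp: Q_def)
  next
    fix t assume "b \<le> t" "Q t"
    then obtain y where y: "a \<le> y" "y < t" "(t, y) islimpt selfint" "mono_at 1 t y"
      by (auto simp: Q_def)
    \<comment> \<open>A change of \<open>y\<close> by less than \<open>t - y\<close> leaves it below
      \<open>t\<close>, hence below any \<open>x\<close> to the right of \<open>t\<close>.\<close>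
    then have "t - y > 0" by simp
    obtain \<delta> where \<delta>: "\<delta> > 0" "\<And>x. \<bar>x - t\<bar> < \<delta> \<Longrightarrow> \<exists>y'. \<bar>y' - y\<bar> < t - y \<and> (x, y') islimpt selfint \<and>
        mono_at 1 x y' \<and> (t < x \<longleftrightarrow> 1 * y < 1 * y')"
      using mono_at_extend[OF y(3,4) \<open>t - y > 0\<close>] by meson
    have "Q x" if x: "t < x" "x < t + \<delta>" for x
    proof -
      obtain y' where y': "\<bar>y' - y\<bar> < t - y" "(x, y') islimpt selfint" "mono_at 1 x y'" "y < y'"
        using \<delta>(2)[of x] x by auto
      then show ?thesis
        using y(1) x(1) unfolding Q_def by (intro exI[of _ y']) auto
    qed
    then show "\<exists>d>0. \<forall>x. t < x \<and> x < t + d \<longrightarrow> Q x"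
      using \<delta>(1) by blast
  next
    fix t assume t: "b < t" "\<forall>x. b \<le> x \<and> x < t \<longrightarrow> Q x"
    obtain X where X: "\<And>n. b < X n" "\<And>n. X n < t" "X \<longlonglongrightarrow> t"
      using sequence_strictly_below[OF t(1)] by blast
    have s_mem: "1 \<in> {1, - 1 :: real}" by simp
    have "closed {p::real\<times>real. snd p \<le> fst p}"
      by (intro closed_Collect_le continuous_intros)
    moreover have "\<exists>y\<in>{a..t}. (X n, y) \<in> {p. snd p \<le> fst p} \<and> (X n, y) islimpt selfint \<and> mono_at 1 (X n) y" for n
    proof -
      have "Q (X n)" using t(2) X(1)[of n] X(2)[of n] by (simp add: less_imp_le)
      then obtain y where "a \<le> y" "y < X n" "(X n, y) islimpt selfint" "mono_at 1 (X n) y"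
        unfolding Q_def by blast
      then show ?thesis using X(2)[of n] by (intro bexI[of _ y]) auto
    qed
    ultimately obtain y where y: "y \<in> {a..t}" "(t, y) \<in> {p. snd p \<le> fst p}" "(t, y) islimpt selfint" "mono_at 1 t y"
      using mono_at_closed_bounded[OF X(3) s_mem, where C = "{p. snd p \<le> fst p}" and lo = a and hi = t] by blast
    moreover have "t \<noteq> y" using limpt_selfint_mem[OF y(3)] by (simp add: selfint_def)
    ultimately show "Q t" unfolding Q_def by force
  qed
  then obtain y where "a \<le> y" "y < x" "(x, y) islimpt selfint" by (auto simp: Q_def)
  then show ?thesis
    using limpt_selfint_mem[of x y] by (intro exI[of _ y]) (auto simp: selfint_def)
qed

section \<open>Covering the range by one interval\<close>

text \<open>The least point of \<open>{a..x}\<close> with the value at \<open>x\<close> cannot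
  exceed \<open>b\<close>: the branch would provide a smaller one that is still at least
  \<open>a\<close>.\<close>

lemma range_right:
  assumes "a < b" "(b, a) islimpt selfint" "mono_at 1 b a" "a \<le> x"
  shows "F (complex_of_real x) \<in> (\<lambda>x. F (complex_of_real x)) ` {a..b}"
proof -
  define Z where "Z = {z \<in> {a..x}. F (complex_of_real z) = F (complex_of_real x)}"
  have "continuous_on UNIV (\<lambda>z. F (complex_of_real z))"
    using isCont_F_real by (simp add: continuous_at_imp_continuous_on)
  then have "closed {z. F (complex_of_real z) = F (complex_of_real x)}"
    by (intro closed_Collect_eq continuous_intros)
  then have "compact ({a..x} \<inter> {z. F (complex_of_real z) = F (complex_of_real x)})"
    by (intro compact_Int_closed compact_Icc)
  moreover have "{a..x} \<inter> {z. F (complex_of_real z) = F (complex_of_real x)} = Z"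
    by (auto simp: Z_def)
  ultimately have "compact Z" by simp
  moreover have "x \<in> Z" using \<open>a \<le> x\<close> by (simp add: Z_def)
  ultimately obtain z where z: "z \<in> Z" "\<And>w. w \<in> Z \<Longrightarrow> z \<le> w"
    using compact_attains_inf[of Z] by blast
  have "z \<le> b"
  proof (rule ccontr)
    assume "\<not> z \<le> b"
    then obtain y where y: "a \<le> y" "y < z" "F (complex_of_real y) = F (complex_of_real z)"
      using increasing_right[OF assms(1-3), of z] by auto
    then have "y \<in> Z" using z(1) by (auto simp: Z_def)
    then show False using z(2)[of y] y(2) by simp
  qed
  then show ?thesis
    using z(1) by (intro image_eqI[of _ _ z]) (auto simp: Z_def)
qed

lemma limpt_selfint_swap:
  assumes "(a, b) islimpt selfint"
  shows "(b, a) islimpt selfint"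
  unfolding islimpt_approachable
proof (intro allI impI)
  fix \<epsilon> :: real assume "\<epsilon> > 0"
  then obtain x y where "(x, y) \<in> selfint" "(x, y) \<noteq> (a, b)" "dist (x, y) (a, b) < \<epsilon>"
    using assms unfolding islimpt_approachable by (metis surj_pair)
  then show "\<exists>p\<in>selfint. p \<noteq> (b, a) \<and> dist p (b, a) < \<epsilon>"
    by (intro bexI[of _ "(y, x)"]) (auto simp: selfint_sym dist_prod_def add.commute)
qed

lemma mono_at_swap:
  assumes "mono_at 1 a b"
  shows "mono_at 1 b a"
proof -
  obtain e where e: "e > 0" "\<And>x y x' y'. (x, y) \<in> selfint \<Longrightarrow> (x', y') \<in> selfint \<Longrightarrow>
     \<bar>x - a\<bar> < e \<Longrightarrow> \<bar>y - b\<bar> < e \<Longrightarrow> \<bar>x' - a\<bar> < e \<Longrightarrow> \<bar>y' - b\<bar> < e \<Longrightarrow> x < x' \<longleftrightarrow> 1 * y < 1 * y'"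
    using assms unfolding mono_at_def by blast
  show ?thesis
    unfolding mono_at_def
  proof (intro exI[of _ e] conjI allI impI)
    fix x y x' y' assume "(x, y) \<in> selfint" "(x', y') \<in> selfint" "\<bar>x - b\<bar> < e" "\<bar>y - a\<bar> < e"
      "\<bar>x' - b\<bar> < e" "\<bar>y' - a\<bar> < e"
    then show "x < x' \<longleftrightarrow> 1 * y < 1 * y'"
      using e(2)[of y x y' x'] selfint_sym by simp
  qed (rule e)
qed

text \<open>Reversing the parameter turns continuation to the left into continuation to the
  right.\<close>

lemma reflect: "locally_injective_analytic (\<lambda>z. F (- z))"
proof
  have "(F \<circ> uminus) analytic_on \<real>"
    by (intro analytic_on_compose analytic_on_neg analytic_on_id[unfolded id_def] analytic_on_subset[OF analytic]) auto
  then show "(\<lambda>z. F (- z)) analytic_on \<real>"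
    by (simp add: o_def)
  show "locally_injective_on_reals (\<lambda>z. F (- z))"
    unfolding locally_injective_on_reals_def
  proof
    fix t :: real
    obtain d where d: "d > 0" "inj_on (\<lambda>x. F (complex_of_real x)) {- t - d<..<- t + d}"
      by (rule injective_nhd)
    have "inj_on (\<lambda>x. F (- complex_of_real x)) {t - d<..<t + d}"
    proof (rule inj_onI)
      fix x y assume "x \<in> {t - d<..<t + d}" "y \<in> {t - d<..<t + d}"
        "F (- complex_of_real x) = F (- complex_of_real y)"
      then show "x = y"
        using inj_onD[OF d(2), of "- x" "- y"] by auto
    qed
    then show "\<exists>a b. a < t \<and> t < b \<and> inj_on (\<lambda>x. F (- complex_of_real x)) {a<..<b}"
      using d(1) by (intro exI[of _ "t - d"] exI[of _ "t + d"]) auto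
  qed
qed

text \<open>For the reflected function both coordinates of every self-intersection are negated,
  which keeps the increasing type and turns \<open>{a..b}\<close> into \<open>{- b..- a}\<close>.
  The limit point \<open>(- a, - b)\<close> now starts at the right end, as
  \<open>N.range_right\<close> requires.\<close>

lemma range_left:
  assumes "a < b" "(a, b) islimpt selfint" "mono_at 1 a b" "x \<le> b"
  shows "F (complex_of_real x) \<in> (\<lambda>x. F (complex_of_real x)) ` {a..b}"
proof -
  interpret N: locally_injective_analytic "\<lambda>z. F (- z)"
    by (rule reflect)
  have N_selfint: "(x, y) \<in> N.selfint \<longleftrightarrow> (- x, - y) \<in> selfint" for x y
    by (simp add: N.selfint_def selfint_def)
  have "(- a, - b) islimpt N.selfint"
    unfolding islimpt_approachable
  proof (intro allI impI)
    fix \<epsilon> :: real assume "\<epsilon> > 0"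
    then obtain x y where xy: "(x, y) \<in> selfint" "(x, y) \<noteq> (a, b)" "dist (x, y) (a, b) < \<epsilon>"
      using assms(2) unfolding islimpt_approachable by (metis surj_pair)
    have "dist (- x, - y) (- a, - b) = dist (x, y) (a, b)"
      by (simp add: dist_prod_def dist_real_def abs_minus_commute)
    then show "\<exists>p\<in>N.selfint. p \<noteq> (- a, - b) \<and> dist p (- a, - b) < \<epsilon>"
      using xy by (intro bexI[of _ "(- x, - y)"]) (auto simp: N_selfint)
  qed
  moreover have "N.mono_at 1 (- a) (- b)"
  proof -
    obtain e where e: "e > 0" "\<And>x y x' y'. (x, y) \<in> selfint \<Longrightarrow> (x', y') \<in> selfint \<Longrightarrow>
       \<bar>x - a\<bar> < e \<Longrightarrow> \<bar>y - b\<bar> < e \<Longrightarrow> \<bar>x' - a\<bar> < e \<Longrightarrow> \<bar>y' - b\<bar> < e \<Longrightarrow> x < x' \<longleftrightarrow> 1 * y < 1 * y'"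
      using assms(3) unfolding mono_at_def by blast
    show ?thesis
      unfolding N.mono_at_def
    proof (intro exI[of _ e] conjI allI impI)
      fix x y x' y' assume H: "(x, y) \<in> N.selfint" "(x', y') \<in> N.selfint" "\<bar>x - - a\<bar> < e" "\<bar>y - - b\<bar> < e"
        "\<bar>x' - - a\<bar> < e" "\<bar>y' - - b\<bar> < e"
      have "\<bar>- x - a\<bar> < e" "\<bar>- y - b\<bar> < e" "\<bar>- x' - a\<bar> < e" "\<bar>- y' - b\<bar> < e"
        using H(3-6) by linarith+
      \<comment> \<open>Negation reverses the order in both coordinates, so the two points change
        places.\<close>
      then show "x < x' \<longleftrightarrow> 1 * y < 1 * y'"
        using e(2)[of "- x'" "- y'" "- x" "- y"] H(1,2) N_selfint by simp
    qed (rule e)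
  qed
  ultimately have "F (- complex_of_real (- x)) \<in> (\<lambda>x. F (- complex_of_real x)) ` {- b..- a}"
    using N.range_right[of "- b" "- a" "- x"] assms(1,4) by simp
  then obtain y where "y \<in> {- b..- a}" "F (complex_of_real x) = F (complex_of_real (- y))"
    by auto
  then show ?thesis by (intro image_eqI[of _ _ "- y"]) auto
qed

lemma uncountable_self_intersections_imp_loop:
  assumes "uncountable selfint"
  shows "is_loop (F ` \<real>)"
proof -
  have "\<exists>p. p islimpt selfint"
  proof (rule ccontr)
    assume "\<nexists>p. p islimpt selfint"
    \<comment> \<open>A subset of the plane without limit points is sparse, and sparse sets are
      countable.\<close>
    then have "selfint sparse_in UNIV" by (auto simp: sparse_in_def)
    then have "countable selfint"
      using sparse_imp_countable[of UNIV selfint] by simp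
    then show False using assms by simp
  qed
  then obtain p q where pq: "(p, q) islimpt selfint" by auto
  then have "p \<noteq> q" using limpt_selfint_mem[OF pq] by (simp add: selfint_def)
  \<comment> \<open>The limit points are symmetric and off the diagonal, so the smaller coordinate
    may come first.\<close>
  obtain a b where ab: "a < b" "(a, b) islimpt selfint"
    using pq limpt_selfint_swap[OF pq] \<open>p \<noteq> q\<close> by (metis linorder_neqE)
  then have inc: "mono_at 1 a b"
    using limpt_selfint_local_structure(1)[OF ab(2)] decreasing_impossible[OF ab] by auto
  \<comment> \<open>As \<open>a < b\<close>, every \<open>x\<close> is at most \<open>b\<close> or
    at least \<open>a\<close>, so one of the two covering results applies.\<close>
  have cover: "F (complex_of_real x) \<in> (\<lambda>x. F (complex_of_real x)) ` {a..b}" for x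
    using range_left[OF ab inc, of x] range_right[OF ab(1) limpt_selfint_swap[OF ab(2)] mono_at_swap[OF inc], of x]
      ab(1) by linarith
  have "(\<lambda>x. F (complex_of_real x)) ` {a..b} = F ` \<real>"
    using cover by (auto simp: Reals_def)
  moreover have "F (complex_of_real a) = F (complex_of_real b)"
    using limpt_selfint_mem[OF ab(2)] by (simp add: selfint_def)
  moreover have "continuous_on {a..b} (\<lambda>x. F (complex_of_real x))"
    using isCont_F_real by (simp add: continuous_at_imp_continuous_on)
  ultimately show ?thesis
    unfolding is_loop_def using ab(1) by blast
qed

end

theorem theorem2:
  fixes F :: "complex \<Rightarrow> complex"
  assumes "F analytic_on \<real>"
    and "locally_injective_on_reals F"
    and "uncountable {(a::real, b::real). a \<noteq> b \<and> F (complex_of_real a) = F (complex_of_real b)}"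
  shows "is_loop (F ` \<real>)"
proof -
  interpret locally_injective_analytic F
    using assms(1,2) by unfold_locales
  show ?thesis
    using uncountable_self_intersections_imp_loop assms(3) unfolding selfint_def by blast
qed

end
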